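(* Let $\nu$ be the product exponential measure on $\mathbb{R}_+^2=[0,\infty)^2$, with density $e^{-x_1-x_2}\mathbf{1}_{\{(x_1,x_2)\in\mathbb{R}_+^2\}}$, and let boundary measures $\nu^+$ be taken with respect to the $\ell_1$-metric. If $A$ is a Borel set in $\mathbb{R}_+^2$, then $$\nu^+(A)\ge \nu^+(B_A),$$ where $B_A$ is the $\ell_1$-ball centred at the origin of the same $\nu$-measure as $A$ if $\nu(A)\ge \frac12$, and the complement in $\mathbb{R}_+^2$ of an $\ell_1$-ball centred at the origin, of the same $\nu$-measure as $A$, if $\nu(A)<\frac12$.
   Context: For a Borel set $A$, its $h$-neighbourhood in the $\ell_1$-metric is $A^h=\{x:\ \exists y\in A,\ \|x-y\|_1<h\}$, and its boundary measure is $\nu^+(A)=\liminf_{h\to0+}\frac{\nu(A^h)-\nu(A)}{h}$ (with value in $[0,\infty]$). The measure $\nu$ is regarded as a measure on $\mathbb{R}^2$ concentrated on $\mathbb{R}_+^2$. $B_1^2$ is the unit ball of the $\ell_1$-norm in $\mathbb{R}^2$ centred at the origin. For a Borel set $A\subset\mathbb{R}_+^2$, the set $B_A$ is defined by $B_A=tB_1^2$ if $\nu(A)\ge\frac12$ and $B_A=\mathbb{R}_+^2\setminus tB_1^2$ if $\nu(A)<\frac12$, where $t\in(0,\infty]$ is the unique number for which $\nu(B_A)=\nu(A)$, with the convention $\infty B_1^2=\mathbb{R}^2$ (so $t=\infty$ exactly when $\nu(A)\in\{0,1\}$). *)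

theory Defs
  imports "HOL-Analysis.Analysis"
begin

definition l1_norm :: "real \<times> real \<Rightarrow> real" where
  "l1_norm x = \<bar>fst x\<bar> + \<bar>snd x\<bar>"

definition quadrant :: "(real \<times> real) set" where
  "quadrant = {x. 0 \<le> fst x \<and> 0 \<le> snd x}"

definition nu :: "(real \<times> real) measure" where
  "nu = density lborel (\<lambda>x. ennreal (exp (- fst x - snd x) * indicator quadrant x))"

definition l1_nbhd :: "(real \<times> real) set \<Rightarrow> real \<Rightarrow> (real \<times> real) set" where
  "l1_nbhd A h = {x. \<exists>y\<in>A. l1_norm (x - y) < h}"

text \<open>
  Since \<open>nu\<close> is a probability measure, the difference quotients are real numbers;
  only their lower limit may be infinite.
\<close>

definition nu_plus :: "(real \<times> real) set \<Rightarrow> ereal" where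
  "nu_plus A =
     Liminf (at_right 0) (\<lambda>h. ereal ((measure nu (l1_nbhd A h) - measure nu A) / h))"

text \<open>
  The closed ball of radius \<open>t\<close> around the origin in the whole plane;
  radius \<open>\<infinity>\<close> gives the plane itself.
\<close>

definition l1_ball :: "ereal \<Rightarrow> (real \<times> real) set" where
  "l1_ball t = {x. ereal (l1_norm x) \<le> t}"

definition extremal_shape :: "(real \<times> real) set \<Rightarrow> ereal \<Rightarrow> (real \<times> real) set" where
  "extremal_shape A t =
     (if measure nu A \<ge> 1 / 2 then l1_ball t else quadrant - l1_ball t)"

text \<open>
  For a Borel set \<open>A\<close> the radius described below exists and is unique: the measure of
  \<open>l1_ball t\<close> is \<open>1 - (1 + t) * exp (- t)\<close> for \<open>0 < t < \<infinity>\<close> and \<open>1\<close> for \<open>t = \<infinity>\<close>.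
\<close>

definition extremal_radius :: "(real \<times> real) set \<Rightarrow> ereal" where
  "extremal_radius A = (THE t. 0 < t \<and> measure nu (extremal_shape A t) = measure nu A)"

definition extremal_set :: "(real \<times> real) set \<Rightarrow> (real \<times> real) set" where
  "extremal_set A = extremal_shape A (extremal_radius A)"

end

theory Submission
  imports Defs "HOL-Real_Asymp.Real_Asymp"
begin

text \<open>
  Since balls \<open>l1_ball t\<close> and their complements have measures \<open>1 - (1 + t) * exp (- t)\<close> and
  \<open>(1 + t) * exp (- t)\<close> and boundary measure \<open>t * exp (- t)\<close>, the theorem says that the boundary
  measure of \<open>A\<close> is at least \<open>I(\<nu>(A))\<close>, where \<open>I(p)\<close> is the perimeter of the ball of measure
  \<open>max p (1 - p)\<close>. The function \<open>I\<close> (\<open>profile\<close> below) is symmetric about \<open>1 / 2\<close>, 1-Lipschitz,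
  and, being concave with \<open>I(0) = 0\<close>, subadditive. Only these properties, together with the perimeter
  of balls and of their complements, enter the argument.

  The measure is uniform on each segment \<open>x\<^sub>1 + x\<^sub>2 = u\<close>. Let \<open>\<ell>(u)\<close>, between \<open>0\<close> and \<open>u\<close>, be
  the length, measured along one coordinate, of the part of the segment that lies in \<open>A\<close>. Moving
  outward by \<open>h\<close> enlarges a nonempty section by \<open>h\<close>, and moving inward preserves the length of a
  section unless there is no room for it. So, where sections are not full, the boundary measure is at
  least the integral of \<open>exp (- u)\<close> against \<open>d\<ell>\<close>, and where they are not empty, it is at least the same
  integral for the complementary length \<open>u - \<ell>(u)\<close>.

  Now scan \<open>u\<close> from \<open>0\<close> to infinity. Let \<open>P(u)\<close> and \<open>Q(u)\<close> be the measures of the parts of \<open>A\<close> and of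
  its complement below level \<open>u\<close>. Because of \<open>d(exp (- u) * \<ell>) = exp (- u) d\<ell> - exp (- u) * \<ell> du\<close> and
  the Lipschitz property, the boundary met below \<open>u\<close> stays at least \<open>I(P(u)) + exp (- u) * \<ell>(u)\<close> as long
  as no section is full. When a full section appears, the second summand is \<open>u * exp (- u)\<close>, the
  perimeter of the complement of a ball, which has measure \<open>G = 1 - P(u) - Q(u)\<close>. Subadditivity and
  symmetry give \<open>I(P(u)) + I(G) \<ge> I(P(u) + G) = I(Q(u))\<close>, and the scan continues with the roles of
  \<open>A\<close> and its complement exchanged, until an empty section appears. At infinity the bound is \<open>I(\<nu>(A))\<close>
  in either case.

  For an arbitrary Borel set \<open>\<ell>\<close> need not have a derivative in any useful sense, so the scan is carried
  out on a grid, where \<open>\<ell>\<close> becomes a sequence of cardinalities. The scan is the induction \<open>end_state\<close>, which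
  leads to \<open>discrete_isoperimetry\<close>: one grid step increases the measure \<open>p\<close> of a union of cells by at least
  \<open>(1 - exp (- \<delta>)) * I(p)\<close>. Iterating steps of a vanishing mesh yields \<open>enlargement_lower_bound\<close>, from
  which the boundary measure is read off.
\<close>

section \<open>The isoperimetric profile\<close>

text \<open>
  A ball of radius \<open>t\<close> has measure \<open>1 - (1 + t) * exp (- t)\<close> and perimeter \<open>t * exp (- t)\<close>.
  As a function of the measure \<open>x = (1 + t) * exp (- t)\<close> outside the ball, the perimeter is
  concave, and \<open>tangent t\<close> is its tangent line at that point.
\<close>

definition tangent :: "real \<Rightarrow> real \<Rightarrow> real" where
  "tangent t x = (1 - 1 / t) * x + exp (- t) / t"

text \<open>
  An infimum of affine functions is concave without any further work, and the symmetric form accounts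
  for both balls and their complements. Tangents at \<open>t \<ge> 1\<close> have slope in \<open>{0..<1}\<close>:
  monotone, so that the smaller of \<open>p\<close> and \<open>1 - p\<close> decides which shape is optimal, and
  1-Lipschitz, so that a set may be altered at a price equal to the measure altered. The range
  suffices because balls that fill at least half of the space have radius above \<open>1\<close>.
\<close>

definition profile :: "real \<Rightarrow> real" where
  "profile p = (INF t\<in>{1..}. min (tangent t p) (tangent t (1 - p)))"

lemma tangent_nonneg: "1 \<le> t \<Longrightarrow> 0 \<le> x \<Longrightarrow> 0 \<le> tangent t x"
  unfolding tangent_def by (intro add_nonneg_nonneg mult_nonneg_nonneg) auto

lemma profile_le_min_tangent:
  assumes "1 \<le> t" "0 \<le> p" "p \<le> 1"
  shows "profile p \<le> min (tangent t p) (tangent t (1 - p))"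
  unfolding profile_def
proof (rule cINF_lower)
  show "bdd_below ((\<lambda>t. min (tangent t p) (tangent t (1 - p))) ` {1..})"
    using assms by (intro bdd_belowI2[where m = 0]) (auto simp: tangent_nonneg)
qed (use assms in auto)

lemma profile_le_tangent:
  assumes "1 \<le> t" "0 \<le> p" "p \<le> 1"
  shows "profile p \<le> tangent t p"
  using profile_le_min_tangent[OF assms] by simp

lemma profile_greatest:
  assumes "\<And>t. 1 \<le> t \<Longrightarrow> c \<le> tangent t p" "\<And>t. 1 \<le> t \<Longrightarrow> c \<le> tangent t (1 - p)"
  shows "c \<le> profile p"
  unfolding profile_def using assms by (intro cINF_greatest) auto

lemma profile_symmetric: "profile (1 - p) = profile p"
  unfolding profile_def by (simp add: min.commute)

lemma profile_nonneg: "0 \<le> p \<Longrightarrow> p \<le> 1 \<Longrightarrow> 0 \<le> profile p"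
  by (intro profile_greatest) (auto simp: tangent_nonneg)

lemma tangent_lipschitz:
  assumes "1 \<le> t"
  shows "tangent t x \<le> tangent t y + \<bar>x - y\<bar>"
proof -
  have "tangent t x - tangent t y = (1 - 1 / t) * (x - y)"
    by (simp add: tangent_def algebra_simps diff_divide_distrib)
  also have "\<dots> \<le> \<bar>1 - 1 / t\<bar> * \<bar>x - y\<bar>"
    by (metis abs_ge_self abs_mult)
  also have "\<dots> \<le> 1 * \<bar>x - y\<bar>"
    using assms by (intro mult_right_mono) (auto simp: abs_le_iff)
  finally show ?thesis by simp
qed

lemma profile_lipschitz:
  assumes "0 \<le> x" "x \<le> 1" "0 \<le> y" "y \<le> 1"
  shows "profile x \<le> profile y + \<bar>x - y\<bar>"
proof -
  have "profile x - \<bar>x - y\<bar> \<le> profile y"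
  proof (rule profile_greatest)
    fix t :: real assume t: "1 \<le> t"
    have *: "profile x \<le> tangent t x" "profile x \<le> tangent t (1 - x)"
      using profile_le_min_tangent[OF t assms(1,2)] by auto
    show "profile x - \<bar>x - y\<bar> \<le> tangent t y"
      using tangent_lipschitz[OF t, of x y] * by linarith
    show "profile x - \<bar>x - y\<bar> \<le> tangent t (1 - y)"
      using tangent_lipschitz[OF t, of "1 - x" "1 - y"] * by linarith
  qed
  then show ?thesis by simp
qed

text \<open>
  Concavity together with a nonnegative value at \<open>0\<close>, checked on each affine function of the
  infimum. It is the form of concavity that yields subadditivity.
\<close>

lemma profile_star_shaped:
  assumes "0 \<le> l" "l \<le> 1" "0 \<le> z" "z \<le> 1"
  shows "l * profile z \<le> profile (l * z)"
proof (rule profile_greatest)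
  fix t :: real assume t: "1 \<le> t"
  have *: "profile z \<le> tangent t z" "profile z \<le> tangent t (1 - z)"
    using profile_le_min_tangent[OF t assms(3,4)] by auto
  have "l * profile z \<le> l * tangent t z + (1 - l) * tangent t 0"
    using mult_left_mono[OF *(1) assms(1)] tangent_nonneg[OF t, of 0] assms(2)
    by (smt (verit) mult_nonneg_nonneg)
  also have "\<dots> = tangent t (l * z)"
    by (simp add: tangent_def algebra_simps diff_divide_distrib)
  finally show "l * profile z \<le> tangent t (l * z)" .
  have "l * profile z \<le> l * tangent t (1 - z) + (1 - l) * tangent t 1"
    using mult_left_mono[OF *(2) assms(1)] tangent_nonneg[OF t, of 1] assms(2)
    by (smt (verit) mult_nonneg_nonneg)
  also have "\<dots> = tangent t (1 - l * z)"
    by (simp add: tangent_def algebra_simps diff_divide_distrib)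
  finally show "l * profile z \<le> tangent t (1 - l * z)" .
qed

lemma profile_subadditive:
  assumes "0 \<le> x" "0 \<le> y" "x + y \<le> 1"
  shows "profile (x + y) \<le> profile x + profile y"
proof (cases "x + y = 0")
  case True
  then have "x = 0" "y = 0" using assms by auto
  then show ?thesis using profile_nonneg[of 0] by simp
next
  case False
  define z where "z = x + y"
  have z: "0 < z" "z \<le> 1" using False assms by (auto simp: z_def)
  have "x / z * profile z \<le> profile (x / z * z)" "y / z * profile z \<le> profile (y / z * z)"
    using assms z by (intro profile_star_shaped; simp add: z_def)+
  then have "x / z * profile z + y / z * profile z \<le> profile x + profile y"
    using z by simp
  moreover have "x / z * profile z + y / z * profile z = profile z"
    using z by (simp add: z_def flip: distrib_right add_divide_distrib)
  ultimately show ?thesis by (simp add: z_def)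
qed

lemma profile_le_self:
  assumes "0 \<le> p" "p \<le> 1"
  shows "profile p \<le> p"
proof -
  have zero: "profile 0 \<le> 0"
  proof (rule field_le_epsilon)
    fix e :: real assume e: "0 < e"
    define t where "t = max 1 (1 / e)"
    have t: "1 \<le> t" "1 / t \<le> e"
      using e by (auto simp: t_def field_simps max_def)
    have "profile 0 \<le> exp (- t) / t"
      using profile_le_tangent[OF t(1), of 0] by (simp add: tangent_def)
    also have "\<dots> \<le> 1 / t" using t by (intro divide_right_mono) auto
    finally show "profile 0 \<le> 0 + e" using t by simp
  qed
  consider "p = 0" | "0 < p" "p \<le> exp (- 1)" | "exp (- 1) < p"
    using assms by linarith
  then show ?thesis
  proof cases
    case 1
    then show ?thesis using zero by simp
  next
    case 2
    define t where "t = - ln p"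
    have t: "1 \<le> t" using 2 ln_le_cancel_iff[of p "exp (-1)"] by (simp add: t_def)
    \<comment> \<open>the tangent at the \<open>t\<close> with \<open>exp (- t) = p\<close> meets the diagonal exactly at \<open>p\<close>\<close>
    have "tangent t p = p" using 2 t by (simp add: tangent_def t_def field_simps)
    then show ?thesis using profile_le_tangent[OF t assms] by simp
  next
    case 3
    then show ?thesis using profile_le_tangent[of 1 p] assms by (simp add: tangent_def)
  qed
qed

lemma profile_zero: "profile 0 = 0"
  using profile_le_self[of 0] profile_nonneg[of 0] by simp

text \<open>
  The tangents of a concave function lie above its graph; for this particular graph the inequality is
  just \<open>1 + y \<le> exp y\<close> with \<open>y = t - s\<close>. The hypothesis says that the ball of radius \<open>t\<close>
  has measure at least one half, and lets monotonicity settle the reflected tangents.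
\<close>

lemma ball_perimeter_le_profile:
  assumes "0 < t" "(1 + t) * exp (- t) \<le> 1 / 2"
  shows "t * exp (- t) \<le> profile ((1 + t) * exp (- t))"
proof (rule profile_greatest)
  fix s :: real assume s: "1 \<le> s"
  have "(1 + (t - s)) * exp (- t) \<le> exp (t - s) * exp (- t)"
    using exp_ge_add_one_self[of "t - s"] by (intro mult_right_mono) auto
  also have "\<dots> = exp (- s)" by (simp flip: exp_add)
  finally have "s * (t * exp (- t)) \<le> (s - 1) * ((1 + t) * exp (- t)) + exp (- s)"
    by (simp add: algebra_simps)
  also have "\<dots> = s * tangent s ((1 + t) * exp (- t))"
    using s by (simp add: tangent_def field_simps)
  finally show *: "t * exp (- t) \<le> tangent s ((1 + t) * exp (- t))"
    using s by simp
  have "tangent s ((1 + t) * exp (- t)) \<le> tangent s (1 - (1 + t) * exp (- t))"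
    unfolding tangent_def using s assms by (intro add_right_mono mult_left_mono) auto
  with * show "t * exp (- t) \<le> tangent s (1 - (1 + t) * exp (- t))" by simp
qed

section \<open>Grid simplices and the profile\<close>

text \<open>
  The cell with index \<open>(i, j)\<close> of a grid of mesh \<open>\<delta>\<close> has measure \<open>(1 - q)\<^sup>2 * q ^ (i + j)\<close>
  with \<open>q = exp (- \<delta>)\<close>. This is the measure of all cells with \<open>i + j \<ge> n\<close>, the discrete
  counterpart of \<open>(1 + t) * exp (- t)\<close>.
\<close>

definition grid_tail :: "real \<Rightarrow> nat \<Rightarrow> real" where
  "grid_tail q n = q ^ n * (1 + n * (1 - q))"

lemma grid_tail_bounds:
  assumes "0 < q" "q < 1"
  shows "0 \<le> grid_tail q n" "grid_tail q n \<le> 1"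
proof -
  show "0 \<le> grid_tail q n" using assms by (simp add: grid_tail_def)
  have "1 + n * (1 - q) \<le> (1 + (1 - q)) ^ n"
    using assms Bernoulli_inequality[of "1 - q" n] by simp
  then have "grid_tail q n \<le> q ^ n * (1 + (1 - q)) ^ n"
    unfolding grid_tail_def using assms by (intro mult_left_mono) auto
  also have "\<dots> = (q * (2 - q)) ^ n" by (simp add: power_mult_distrib)
  also have "\<dots> \<le> 1"
  proof (rule power_le_one)
    have "0 \<le> (1 - q)\<^sup>2" by simp
    then show "q * (2 - q) \<le> 1" by (simp add: power2_eq_square algebra_simps)
  qed (use assms in auto)
  finally show "grid_tail q n \<le> 1" .
qed

text \<open>
  The right-hand side is the measure, divided by \<open>1 - q\<close>, of the layer of cells which one step adds
  to the simplex \<open>i + j < n\<close> or to the complement of the simplex \<open>i + j < n + 1\<close>. So grid simplices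
  and their complements obey the isoperimetric inequality for the continuous profile without any
  discretisation error. This matters since later arguments use the bound once for every change between
  full and empty levels, and errors would accumulate. Small simplices are compared with the diagonal
  bound \<open>profile p \<le> p\<close> at their measure \<open>p\<close>, large ones with the tangent at the true radius \<open>n * \<delta>\<close>.
\<close>

lemma profile_grid_tail_le:
  fixes \<delta> :: real
  assumes \<delta>: "0 < \<delta>" "\<delta> \<le> 1 / 8" and q: "q = exp (- \<delta>)"
  shows "profile (grid_tail q n) \<le> (1 - q) * q ^ n * (n + 1)"
    and "profile (grid_tail q (Suc n)) \<le> (1 - q) * q ^ n * (n + 1)"
proof -
  define \<theta> where "\<theta> = 1 - q"
  have q01: "0 < q" "q < 1" using \<delta> q by auto
  then have \<theta>: "0 < \<theta>" "\<theta> < 1" by (auto simp: \<theta>_def)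
  have \<theta>_low: "\<delta> - \<delta>\<^sup>2 / 2 \<le> \<theta>"
  proof -
    have "exp (- \<delta>) * (1 + \<delta> + \<delta>\<^sup>2 / 2) \<le> 1"
      using mult_left_mono[OF exp_lower_Taylor_quadratic[of \<delta>], of "exp (- \<delta>)"] \<delta>
      by (simp add: exp_minus field_simps)
    moreover have "(1 - \<delta> + \<delta>\<^sup>2 / 2) * (1 + \<delta> + \<delta>\<^sup>2 / 2) = 1 + (\<delta>\<^sup>2 / 2)\<^sup>2"
      by (simp add: algebra_simps power2_eq_square)
    ultimately have "exp (- \<delta>) * (1 + \<delta> + \<delta>\<^sup>2 / 2) \<le> (1 - \<delta> + \<delta>\<^sup>2 / 2) * (1 + \<delta> + \<delta>\<^sup>2 / 2)"
      using zero_le_power2[of "\<delta>\<^sup>2 / 2"] by linarith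
    moreover have "0 < 1 + \<delta> + \<delta>\<^sup>2 / 2" using \<delta> by (simp add: add_pos_nonneg)
    ultimately have "exp (- \<delta>) \<le> 1 - \<delta> + \<delta>\<^sup>2 / 2" by (rule mult_right_le_imp_le)
    then show ?thesis by (simp add: \<theta>_def q)
  qed
  have qn: "q ^ m = exp (- (m * \<delta>))" for m :: nat
    by (simp add: q exp_of_nat_mult[symmetric])
  \<comment> \<open>the chord of \<open>exp\<close> over \<open>{0..1}\<close> has slope \<open>exp 1 - 1\<close>, which must not exceed \<open>2 - \<delta>\<close>\<close>
  have e_bound: "exp 1 \<le> (23 / 8 :: real)"
  proof -
    have "exp (1 / 8 :: real) \<le> 73 / 64"
      using exp_bound[of "1 / 8 :: real"] by (simp add: power2_eq_square)
    then have "exp (1 / 8 :: real) ^ 8 \<le> (73 / 64) ^ 8" by (intro power_mono) auto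
    also have "(73 / 64) ^ 8 \<le> (23 / 8 :: real)" by (simp add: power_divide)
    finally show ?thesis by (simp flip: exp_of_nat_mult)
  qed
  have near: "profile (grid_tail q m) \<le> \<theta> * m * q ^ m" if m: "m * \<delta> \<le> 1" for m :: nat
  proof -
    define t where "t = m * \<delta>"
    have t: "0 \<le> t" "t \<le> 1" using m \<delta> by (auto simp: t_def)
    have "exp t \<le> 1 + (exp 1 - 1) * t"
      using convex_onD[OF exp_convex, of t 0 1] t by (simp add: algebra_simps)
    also have "\<dots> \<le> 1 + (2 - \<delta>) * t"
      using e_bound \<delta> t by (intro add_left_mono mult_right_mono) auto
    also have "\<dots> = 1 + 2 * m * (\<delta> - \<delta>\<^sup>2 / 2)"
      by (simp add: t_def power2_eq_square algebra_simps)
    also have "\<dots> \<le> 1 + 2 * m * \<theta>"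
      using \<theta>_low by (intro add_left_mono mult_left_mono) auto
    finally have "exp (- t) * exp t \<le> exp (- t) * (1 + 2 * m * \<theta>)"
      by (intro mult_left_mono) auto
    then have "1 \<le> q ^ m * (1 + 2 * m * \<theta>)"
      by (simp add: qn t_def flip: exp_add)
    then have "1 - grid_tail q m \<le> \<theta> * m * q ^ m"
      by (simp add: grid_tail_def \<theta>_def algebra_simps)
    moreover have "profile (grid_tail q m) \<le> 1 - grid_tail q m"
      using profile_le_self[of "1 - grid_tail q m"] grid_tail_bounds[OF q01, of m]
      by (simp add: profile_symmetric)
    ultimately show ?thesis by simp
  qed
  have far: "profile (grid_tail q m) \<le> q ^ m * (\<theta> * m + \<delta> / 2)" if m: "1 \<le> m * \<delta>" for m :: nat
  proof -
    have m0: "0 < m" using m by (cases m) auto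
    have "profile (grid_tail q m) \<le> tangent (m * \<delta>) (grid_tail q m)"
      using m grid_tail_bounds[OF q01, of m] by (intro profile_le_tangent) auto
    also have "\<dots> = q ^ m * (\<theta> * m + (1 - \<theta> / \<delta>))"
    proof -
      have "c * (y * x) + y / t = y * (c * x + 1 / t)" for c x y t :: real
        by (simp add: algebra_simps)
      then have "tangent (m * \<delta>) (grid_tail q m)
          = q ^ m * ((1 - 1 / (m * \<delta>)) * (1 + m * \<theta>) + 1 / (m * \<delta>))"
        unfolding tangent_def grid_tail_def qn[symmetric] \<theta>_def .
      also have "(1 - 1 / (m * \<delta>)) * (1 + m * \<theta>) + 1 / (m * \<delta>) = \<theta> * m + (1 - \<theta> / \<delta>)"
        using m0 \<delta> by (simp add: field_simps)
      finally show ?thesis .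
    qed
    also have "\<dots> \<le> q ^ m * (\<theta> * m + \<delta> / 2)"
    proof -
      have "1 - \<theta> / \<delta> \<le> \<delta> / 2"
        using \<theta>_low \<delta> by (simp add: field_simps power2_eq_square)
      then show ?thesis using q01 by (intro mult_left_mono) auto
    qed
    finally show ?thesis .
  qed
  show "profile (grid_tail q n) \<le> (1 - q) * q ^ n * (n + 1)"
  proof (cases "n * \<delta> \<le> 1")
    case True
    have "\<theta> * n * q ^ n \<le> \<theta> * q ^ n * (n + 1)"
      using \<theta> q01 by (simp add: algebra_simps)
    with near[OF True] show ?thesis by (simp add: \<theta>_def)
  next
    case False
    have "\<delta>\<^sup>2 \<le> \<delta>" using \<delta> by (simp add: power2_eq_square mult_left_le_one_le)
    then have "\<delta> / 2 \<le> \<theta>" using \<theta>_low by simp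
    then have "q ^ n * (\<theta> * n + \<delta> / 2) \<le> q ^ n * (\<theta> * n + \<theta>)"
      using q01 by (intro mult_left_mono) auto
    with far[of n] False show ?thesis by (simp add: \<theta>_def algebra_simps)
  qed
  show "profile (grid_tail q (Suc n)) \<le> (1 - q) * q ^ n * (n + 1)"
  proof (cases "Suc n * \<delta> \<le> 1")
    case True
    have "\<theta> * Suc n * q ^ Suc n \<le> \<theta> * Suc n * q ^ n"
      using \<theta> q01 by (intro mult_left_mono power_decreasing) auto
    with near[OF True] show ?thesis by (simp add: \<theta>_def algebra_simps)
  next
    case False
    define m where "m = Suc n"
    have m: "1 \<le> m * \<delta>" using False unfolding m_def by linarith
    \<comment> \<open>this is \<open>\<delta> / 2 \<le> sinh (\<delta> / 2)\<close>, multiplied by \<open>2 * exp (- \<delta> / 2)\<close> and squared\<close>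
    have "\<delta>\<^sup>2 * q \<le> \<theta>\<^sup>2"
    proof -
      define s where "s = exp (- (\<delta> / 2))"
      have s: "0 < s" "s * s = q" "exp (\<delta> / 2) * s = 1"
        by (auto simp: s_def q simp flip: exp_add)
      have "\<delta> \<le> exp (\<delta> / 2) - s"
        using real_le_x_sinh[of "\<delta> / 2"] \<delta> by (simp add: s_def exp_minus)
      then have "\<delta> * s \<le> (exp (\<delta> / 2) - s) * s" using s by (intro mult_right_mono) auto
      also have "\<dots> = \<theta>" using s by (simp add: \<theta>_def algebra_simps)
      finally have "(\<delta> * s)\<^sup>2 \<le> \<theta>\<^sup>2" using \<delta> s by (intro power_mono) auto
      then show ?thesis using s by (simp add: power2_eq_square algebra_simps)
    qed
    then have "m * (\<delta>\<^sup>2 * q) \<le> m * \<theta>\<^sup>2" by (intro mult_left_mono) auto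
    moreover have "1 * (\<delta> * q) \<le> (m * \<delta>) * (\<delta> * q)"
      using m \<delta> q01 by (intro mult_right_mono) auto
    moreover have "0 \<le> \<delta> * q" using \<delta> q01 by simp
    ultimately have "q * (\<delta> / 2) \<le> m * \<theta>\<^sup>2"
      unfolding power2_eq_square by (simp add: algebra_simps)
    then have "q * (\<theta> * m + \<delta> / 2) \<le> \<theta> * m"
      by (simp add: \<theta>_def power2_eq_square algebra_simps)
    then have "q ^ n * (q * (\<theta> * m + \<delta> / 2)) \<le> q ^ n * (\<theta> * m)"
      using q01 by (intro mult_left_mono) auto
    with far[OF m] show ?thesis by (simp add: \<theta>_def m_def algebra_simps)
  qed
qed

section \<open>Neighbours of sets of cells, level by level\<close>

definition grid_step :: "(nat \<times> nat) set \<Rightarrow> (nat \<times> nat) set" where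
  "grid_step S = {(i, j). \<exists>(k, l)\<in>S. \<bar>int i - int k\<bar> + \<bar>int j - int l\<bar> \<le> 1}"

definition slice :: "(nat \<times> nat) set \<Rightarrow> nat \<Rightarrow> nat set" where
  "slice S n = {i. i \<le> n \<and> (i, n - i) \<in> S}"

lemma slice_subset: "slice S n \<subseteq> {..n}"
  by (auto simp: slice_def)

lemma finite_slice [simp]: "finite (slice S n)"
  using slice_subset finite_subset by blast

lemma card_slice_le: "card (slice S n) \<le> Suc n"
  using card_mono[OF _ slice_subset[of S n]] by simp

lemma subset_grid_step: "S \<subseteq> grid_step S"
  by (force simp: grid_step_def)

lemma card_slice_le_grid_step: "card (slice S n) \<le> card (slice (grid_step S) n)"
  using subset_grid_step[of S] by (intro card_mono) (auto simp: slice_def)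

lemma grid_step_slice_above:
  "slice S n \<union> Suc ` slice S n \<subseteq> slice (grid_step S) (Suc n)"
proof -
  have "i \<in> slice (grid_step S) (Suc n) \<and> Suc i \<in> slice (grid_step S) (Suc n)"
    if "i \<in> slice S n" for i
  proof -
    have i: "i \<le> n" "(i, n - i) \<in> S" using that by (auto simp: slice_def)
    have "(i, Suc n - i) \<in> grid_step S" "(Suc i, Suc n - Suc i) \<in> grid_step S"
      using i unfolding grid_step_def by (auto intro!: bexI[of _ "(i, n - i)"])
    then show ?thesis using i by (simp add: slice_def)
  qed
  then show ?thesis by auto
qed

lemma grid_step_slice_below:
  "{i. i \<le> n \<and> (i \<in> slice S (Suc n) \<or> Suc i \<in> slice S (Suc n))} \<subseteq> slice (grid_step S) n"
proof -
  have "i \<in> slice (grid_step S) n" if "i \<le> n" "i \<in> slice S (Suc n)" for i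
  proof -
    have "(i, Suc n - i) \<in> S" using that by (auto simp: slice_def)
    then have "(i, n - i) \<in> grid_step S"
      using that unfolding grid_step_def by (auto intro!: bexI[of _ "(i, Suc n - i)"])
    then show ?thesis using that by (simp add: slice_def)
  qed
  moreover have "i \<in> slice (grid_step S) n" if "i \<le> n" "Suc i \<in> slice S (Suc n)" for i
  proof -
    have "(Suc i, n - i) \<in> S" using that by (auto simp: slice_def)
    then have "(i, n - i) \<in> grid_step S"
      using that unfolding grid_step_def by (auto intro!: bexI[of _ "(Suc i, n - i)"])
    then show ?thesis using that by (simp add: slice_def)
  qed
  ultimately show ?thesis by auto
qed

text \<open>
  Every cell has two outer neighbours on the next level, \<open>i\<close> and \<open>i + 1\<close>, and the set \<open>T \<union> (T + 1)\<close>
  is larger than \<open>T\<close>.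
\<close>

lemma card_slice_above:
  assumes "0 < card (slice S n)"
  shows "card (slice S n) + 1 \<le> card (slice (grid_step S) (Suc n))"
proof -
  define T where "T = slice S n"
  have T: "finite T" "T \<noteq> {}" using assms by (auto simp: T_def)
  have "Min T \<notin> Suc ` T"
    using Min_le[OF T(1)] by (metis Suc_n_not_le_n imageE)
  then have "card T + 1 = card (insert (Min T) (Suc ` T))"
    using T by (simp add: card_image)
  also have "\<dots> \<le> card (slice (grid_step S) (Suc n))"
    using grid_step_slice_above[of S n] Min_in[OF T] unfolding T_def
    by (intro card_mono finite_slice) blast
  finally show ?thesis by (simp add: T_def)
qed

text \<open>
  Towards the origin a level can only shrink, but a slice \<open>T\<close> that misses some cell \<open>c\<close> keeps its
  cardinality: indices below \<open>c\<close> stay, indices above \<open>c\<close> move down by one, and both kinds of move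
  lead to neighbours.
\<close>

lemma card_slice_below:
  "min (card (slice S (Suc n))) (Suc n) \<le> card (slice (grid_step S) n)"
proof -
  define T where "T = slice S (Suc n)"
  have below: "{i. i \<le> n \<and> (i \<in> T \<or> Suc i \<in> T)} \<subseteq> slice (grid_step S) n"
    using grid_step_slice_below[of n S] by (simp add: T_def)
  show ?thesis
  proof (cases "T = {..Suc n}")
    case True
    then have "{..n} \<subseteq> slice (grid_step S) n" using below by auto
    then have "card {..n} \<le> card (slice (grid_step S) n)" by (intro card_mono) auto
    then show ?thesis by simp
  next
    case False
    then obtain c where c: "c \<le> Suc n" "c \<notin> T"
      using slice_subset[of S "Suc n"] by (auto simp: T_def)
    define f where "f i = (if i < c then i else i - 1)" for i :: nat
    have "inj_on f T"
    proof (rule inj_onI)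
      fix i j assume "i \<in> T" "j \<in> T" and eq: "f i = f j"
      then have "i \<noteq> c" "j \<noteq> c" using c by auto
      with eq show "i = j" unfolding f_def by presburger
    qed
    moreover have "f ` T \<subseteq> {i. i \<le> n \<and> (i \<in> T \<or> Suc i \<in> T)}"
    proof
      fix x assume "x \<in> f ` T"
      then obtain i where i: "i \<in> T" "x = f i" by auto
      have "i \<le> Suc n" using i slice_subset[of S "Suc n"] by (auto simp: T_def)
      moreover have "i \<noteq> c" using i c by auto
      ultimately show "x \<in> {i. i \<le> n \<and> (i \<in> T \<or> Suc i \<in> T)}"
        using i c by (cases "i < c"; cases i) (auto simp: f_def)
    qed
    ultimately have "card T \<le> card (slice (grid_step S) n)"
      using below by (intro card_inj_on_le[of f]) auto
    then show ?thesis by (simp add: T_def)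
  qed
qed

section \<open>The discrete isoperimetric inequality\<close>

text \<open>
  All that is kept of a set of cells \<open>S\<close> are the numbers \<open>a n\<close> of its cells on the levels
  \<open>i + j = n\<close>; similarly \<open>b\<close> for the set reached in one step. The last three conditions are the
  only geometric input.
\<close>

locale level_sequences =
  fixes \<delta> q :: real and a b :: "nat \<Rightarrow> nat"
  assumes \<delta>: "0 < \<delta>" "\<delta> \<le> 1 / 8" and q: "q = exp (- \<delta>)"
    and a_le: "\<And>n. a n \<le> Suc n"
    and stay: "\<And>n. a n \<le> b n"
    and up: "\<And>n. 0 < a n \<Longrightarrow> a n + 1 \<le> b (Suc n)"
    and down: "\<And>n. min (a (Suc n)) (Suc n) \<le> b n"
begin

definition inside :: "nat \<Rightarrow> real" where
  "inside n = (\<Sum>m<n. (1 - q)\<^sup>2 * q ^ m * a m)"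

definition outside :: "nat \<Rightarrow> real" where
  "outside n = (\<Sum>m<n. (1 - q)\<^sup>2 * q ^ m * (real (Suc m) - a m))"

text \<open>
  Measures of cells divided by \<open>1 - q\<close>, which approximates the mesh: growth is on the scale of
  perimeters.
\<close>

definition growth :: "nat \<Rightarrow> real" where
  "growth n = (\<Sum>m<n. (1 - q) * q ^ m * (real (b m) - a m))"

lemma q01: "0 < q" "q < 1"
  using \<delta> by (auto simp: q)

lemma mass_partition: "inside n + outside n + grid_tail q n = 1"
proof (induction n)
  case 0
  show ?case by (simp add: inside_def outside_def grid_tail_def)
next
  case (Suc n)
  have "inside (Suc n) + outside (Suc n) + grid_tail q (Suc n)
      = inside n + outside n + ((1 - q)\<^sup>2 * q ^ n * Suc n + grid_tail q (Suc n))"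
    by (simp add: inside_def outside_def algebra_simps)
  also have "(1 - q)\<^sup>2 * q ^ n * Suc n + grid_tail q (Suc n) = grid_tail q n"
    by (simp add: grid_tail_def power2_eq_square algebra_simps)
  finally show ?case using Suc by simp
qed

lemma inside_nonneg: "0 \<le> inside n"
  unfolding inside_def using q01 by (intro sum_nonneg mult_nonneg_nonneg) auto

lemma outside_nonneg: "0 \<le> outside n"
  unfolding outside_def using q01 a_le
  by (intro sum_nonneg mult_nonneg_nonneg) (auto simp del: of_nat_Suc)

lemma mass_bounds:
  "inside n \<le> 1" "outside n \<le> 1" "inside n + grid_tail q n \<le> 1" "outside n + grid_tail q n \<le> 1"
  using mass_partition[of n] inside_nonneg[of n] outside_nonneg[of n]
    grid_tail_bounds[OF q01, of n] by linarith+

text \<open>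
  Three lower bounds for growth, one of which holds at every level. In \<open>empty_end\<close> the growth below
  level \<open>n\<close> accounts for the profile of the part inside and for a reserve, the price of cutting the set
  off at level \<open>n\<close>; once true, it stays true until a level is full. The bound \<open>full_end\<close> is the
  same statement for the complement. It is shifted by one level, because inward moves show up as growth
  of the previous level but outward moves as growth of the next one; a level that has just become full
  therefore needs the intermediate bound \<open>just_filled\<close>. The disjunction in \<open>full_end\<close> excludes two
  consecutive empty levels: from an empty level nothing moves outward, so the second of them need not
  grow although it misses one cell more than the first.
\<close>

definition empty_end :: "nat \<Rightarrow> bool" where
  "empty_end n \<longleftrightarrow> profile (inside n) + (1 - q) * q ^ n / q * a n \<le> growth n"

definition just_filled :: "nat \<Rightarrow> bool" where
  "just_filled n \<longleftrightarrow> a n = Suc n \<and> profile (outside n) \<le> growth n"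

definition full_end :: "nat \<Rightarrow> bool" where
  "full_end n \<longleftrightarrow> (0 < a n \<or> 0 < a (Suc n)) \<and>
     profile (outside (Suc n)) + (1 - q) * q ^ Suc n * (real (Suc n) - a n) \<le> growth (Suc n)"

lemma inside_Suc: "inside (Suc n) = inside n + (1 - q)\<^sup>2 * q ^ n * a n"
  by (simp add: inside_def)

lemma outside_Suc: "outside (Suc n) = outside n + (1 - q)\<^sup>2 * q ^ n * (real (Suc n) - a n)"
  by (simp add: outside_def)

lemma profile_inside_Suc:
  "profile (inside (Suc n)) \<le> profile (inside n) + (1 - q)\<^sup>2 * q ^ n * a n"
proof -
  have "0 \<le> (1 - q)\<^sup>2 * q ^ n * a n" using q01 by simp
  moreover have "profile (inside (Suc n)) \<le> profile (inside n) + \<bar>inside (Suc n) - inside n\<bar>"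
    by (intro profile_lipschitz inside_nonneg mass_bounds)
  ultimately show ?thesis by (simp add: inside_Suc)
qed

lemma profile_outside_Suc:
  "profile (outside (Suc n)) \<le> profile (outside n) + (1 - q)\<^sup>2 * q ^ n * (real (Suc n) - a n)"
proof -
  have "0 \<le> (1 - q)\<^sup>2 * q ^ n * (real (Suc n) - a n)"
    using q01 a_le[of n] by (intro mult_nonneg_nonneg) auto
  moreover have "profile (outside (Suc n)) \<le> profile (outside n) + \<bar>outside (Suc n) - outside n\<bar>"
    by (intro profile_lipschitz outside_nonneg mass_bounds)
  ultimately show ?thesis by (simp add: outside_Suc)
qed

lemma growth_Suc_ge:
  assumes "real (a n) + x \<le> b n"
  shows "growth n + (1 - q) * q ^ n * x \<le> growth (Suc n)"
  unfolding growth_def using assms q01 by (simp add: mult_left_mono)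

text \<open>
  As long as the next level is not full, the inward moves pay for its excess over the present one, and
  the geometric weight releases enough of the reserve to pay, by the Lipschitz bound, for the measure
  that joins the inside. If the next level is full, the reserve has grown to the perimeter of the
  complement of a simplex; by subadditivity this pays for exchanging the inside for the outside.
\<close>

lemma empty_end_step:
  assumes "empty_end n"
  shows "empty_end (Suc n) \<or> just_filled (Suc n)"
proof -
  define \<theta> where "\<theta> = 1 - q"
  have \<theta>: "0 < \<theta>" "q = 1 - \<theta>" using q01 by (auto simp: \<theta>_def)
  have inv_q: "1 + \<theta> \<le> 1 / q"
  proof -
    have "0 \<le> \<theta>\<^sup>2" by simp
    then have "(1 + \<theta>) * q \<le> 1" by (simp add: \<theta>(2) power2_eq_square algebra_simps)
    then show ?thesis using q01 by (simp add: field_simps)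
  qed
  have "\<theta> * q ^ n * a n * (1 + \<theta>) \<le> \<theta> * q ^ n * a n * (1 / q)"
    using inv_q \<theta> q01 by (intro mult_left_mono) auto
  moreover have "(1 - q)\<^sup>2 * q ^ n * a n + \<theta> * q ^ n * a n = \<theta> * q ^ n * a n * (1 + \<theta>)"
    by (simp add: \<theta>_def power2_eq_square algebra_simps)
  moreover have "\<theta> * q ^ n * a n * (1 / q) = \<theta> * q ^ n / q * a n"
    by simp
  ultimately have "profile (inside (Suc n)) + \<theta> * q ^ n * a n \<le> profile (inside n) + \<theta> * q ^ n / q * a n"
    using profile_inside_Suc[of n] by linarith
  then have base: "profile (inside (Suc n)) + \<theta> * q ^ n * a n \<le> growth n"
    using assms by (simp add: empty_end_def \<theta>_def)
  show ?thesis
  proof (cases "a (Suc n) \<le> Suc n")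
    case True
    then have "real (a n) + (real (a (Suc n)) - a n) \<le> b n" using down[of n] by simp
    from growth_Suc_ge[OF this] base
    have "profile (inside (Suc n)) + \<theta> * q ^ n * a (Suc n) \<le> growth (Suc n)"
      by (simp add: \<theta>_def algebra_simps)
    then have "empty_end (Suc n)"
      using q01 by (simp add: empty_end_def \<theta>_def)
    then show ?thesis ..
  next
    case False
    then have full: "a (Suc n) = Suc (Suc n)" using a_le[of "Suc n"] by simp
    then have "real (a n) + (real (Suc n) - a n) \<le> b n" using down[of n] by simp
    from growth_Suc_ge[OF this] base
    have "profile (inside (Suc n)) + \<theta> * q ^ n * Suc n \<le> growth (Suc n)"
      by (simp add: \<theta>_def algebra_simps)
    moreover have "profile (inside (Suc n) + grid_tail q (Suc n))
        \<le> profile (inside (Suc n)) + profile (grid_tail q (Suc n))"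
      using inside_nonneg mass_bounds grid_tail_bounds[OF q01] by (intro profile_subadditive)
    moreover have "profile (grid_tail q (Suc n)) \<le> \<theta> * q ^ n * Suc n"
      using profile_grid_tail_le(2)[OF \<delta> q, of n] by (simp add: \<theta>_def algebra_simps)
    moreover have "outside (Suc n) = 1 - (inside (Suc n) + grid_tail q (Suc n))"
      using mass_partition[of "Suc n"] by simp
    ultimately have "profile (outside (Suc n)) \<le> growth (Suc n)"
      by (simp only: profile_symmetric)
    with full show ?thesis by (simp add: just_filled_def)
  qed
qed

lemma just_filled_step:
  assumes "just_filled n"
  shows "full_end n"
proof -
  have "growth n \<le> growth (Suc n)"
    using growth_Suc_ge[of n 0] stay[of n] by simp
  then show ?thesis
    using assms by (simp add: just_filled_def full_end_def outside_def)
qed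

text \<open>
  The same argument for the complement, driven by the outward moves. Here the exchange happens once two
  consecutive levels are empty, and the reserve has then become the perimeter of a simplex.
\<close>

lemma full_end_step:
  assumes "full_end n"
  shows "full_end (Suc n) \<or> empty_end (Suc (Suc n))"
proof -
  define m where "m = Suc n"
  define \<theta> where "\<theta> = 1 - q"
  have \<theta>: "0 < \<theta>" "q = 1 - \<theta>" using q01 by (auto simp: \<theta>_def)
  \<comment> \<open>if level \<open>n\<close> is empty then nothing moves outward, but level \<open>m\<close> is not empty
    and so misses no more cells than level \<open>n\<close>\<close>
  have "real (a m) + ((real (Suc m) - a m) - (real (Suc n) - a n)) \<le> b m"
  proof (cases "0 < a n")
    case True
    then show ?thesis using up[of n] by (simp add: m_def)
  next
    case False
    then show ?thesis using assms stay[of m] by (simp add: full_end_def m_def)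
  qed
  from growth_Suc_ge[OF this] assms
  have base: "profile (outside m) + \<theta> * q ^ m * (real (Suc m) - a m) \<le> growth (Suc m)"
    by (simp add: full_end_def m_def \<theta>_def algebra_simps)
  show ?thesis
  proof (cases "a m = 0 \<and> a (Suc m) = 0")
    case True
    have "profile (outside m + grid_tail q m) \<le> profile (outside m) + profile (grid_tail q m)"
      using outside_nonneg mass_bounds grid_tail_bounds[OF q01] by (intro profile_subadditive)
    moreover have "profile (grid_tail q m) \<le> \<theta> * q ^ m * Suc m"
      using profile_grid_tail_le(1)[OF \<delta> q, of m] by (simp add: \<theta>_def algebra_simps)
    moreover have "inside m = 1 - (outside m + grid_tail q m)"
      using mass_partition[of m] by simp
    ultimately have "profile (inside m) \<le> growth (Suc m)"
      using base True by (simp add: profile_symmetric)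
    moreover have "inside (Suc m) = inside m" using True by (simp add: inside_def)
    ultimately have "empty_end (Suc m)" using True by (simp add: empty_end_def)
    then show ?thesis by (simp add: m_def)
  next
    case False
    have "profile (outside (Suc m)) + \<theta> * q ^ Suc m * (real (Suc m) - a m) \<le> growth (Suc m)"
      using base profile_outside_Suc[of m]
      by (simp add: \<theta>(2) power2_eq_square algebra_simps)
    then have "full_end m" using False by (auto simp: full_end_def \<theta>_def)
    then show ?thesis by (simp add: m_def)
  qed
qed

lemma end_state: "empty_end (Suc n) \<or> just_filled (Suc n) \<or> full_end n"
proof (induction n)
  case 0
  have "empty_end 0 \<or> just_filled 0"
    using a_le[of 0] by (cases "a 0")
      (auto simp: empty_end_def just_filled_def inside_def outside_def growth_def profile_zero)
  then show ?case using empty_end_step just_filled_step by blast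
next
  case (Suc n)
  then show ?case using empty_end_step just_filled_step full_end_step by blast
qed

lemma profile_inside_le_growth:
  "profile (inside (Suc n)) \<le> growth (Suc n) + grid_tail q (Suc n)"
proof -
  define m where "m = Suc n"
  have pos: "0 \<le> grid_tail q m" by (rule grid_tail_bounds[OF q01])
  have *: "profile (inside m) \<le> profile (outside m) + grid_tail q m"
  proof -
    have "profile (inside m) \<le> profile (inside m + grid_tail q m) + \<bar>inside m - (inside m + grid_tail q m)\<bar>"
      using inside_nonneg mass_bounds pos by (intro profile_lipschitz) auto
    moreover have "inside m + grid_tail q m = 1 - outside m" using mass_partition[of m] by simp
    ultimately show ?thesis using pos by (simp add: profile_symmetric)
  qed
  have "empty_end m \<or> just_filled m \<or> full_end n" using end_state[of n] by (simp add: m_def)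
  moreover have "0 \<le> (1 - q) * q ^ m / q * a m" "0 \<le> (1 - q) * q ^ m * (real m - a n)"
    using q01 a_le[of n] unfolding m_def by (auto intro!: mult_nonneg_nonneg divide_nonneg_nonneg)
  ultimately show ?thesis
    using * pos unfolding empty_end_def just_filled_def full_end_def m_def[symmetric]
    by (elim disjE) auto
qed

text \<open>
  Each of the three bounds controls the profile of the inside up to the measure of the remaining
  levels, which tends to \<open>0\<close>.
\<close>

theorem discrete_isoperimetry:
  assumes A: "(\<lambda>n. (1 - q)\<^sup>2 * q ^ n * a n) sums p"
    and B: "(\<lambda>n. (1 - q)\<^sup>2 * q ^ n * b n) sums p'"
  shows "p + (1 - q) * profile p \<le> p'"
proof -
  have tail: "(\<lambda>n. grid_tail q (Suc n)) \<longlonglongrightarrow> 0"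
  proof -
    have norm_q: "norm q < 1" using q01 by simp
    have "(\<lambda>n. real n * q ^ n) \<longlonglongrightarrow> 0" "(\<lambda>n. q ^ n) \<longlonglongrightarrow> 0"
      using powser_times_n_limit_0[OF norm_q] LIMSEQ_power_zero[OF norm_q] by simp_all
    from tendsto_add[OF this(2) tendsto_mult[OF tendsto_const this(1), of "1 - q"]]
    have "(\<lambda>n. q ^ n + (1 - q) * (real n * q ^ n)) \<longlonglongrightarrow> 0 + (1 - q) * 0" .
    then have "(\<lambda>n. grid_tail q n) \<longlonglongrightarrow> 0"
      by (simp add: grid_tail_def algebra_simps)
    then show ?thesis by (rule LIMSEQ_Suc)
  qed
  have ins: "(\<lambda>n. inside (Suc n)) \<longlonglongrightarrow> p"
    using LIMSEQ_Suc[OF A[unfolded sums_def]] unfolding inside_def .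
  have gro: "(\<lambda>n. (1 - q) * growth (Suc n)) \<longlonglongrightarrow> p' - p"
  proof -
    have "(\<lambda>n. (1 - q)\<^sup>2 * q ^ n * b n - (1 - q)\<^sup>2 * q ^ n * a n) sums (p' - p)"
      by (rule sums_diff[OF B A])
    also have "(\<lambda>n. (1 - q)\<^sup>2 * q ^ n * b n - (1 - q)\<^sup>2 * q ^ n * a n)
        = (\<lambda>n. (1 - q) * ((1 - q) * q ^ n * (real (b n) - a n)))"
      by (auto simp: power2_eq_square algebra_simps)
    finally show ?thesis
      unfolding sums_def growth_def sum_distrib_left[symmetric] by (rule LIMSEQ_Suc)
  qed
  have p: "0 \<le> p" "p \<le> 1"
    using LIMSEQ_le_const[OF ins] LIMSEQ_le_const2[OF ins] inside_nonneg mass_bounds by auto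
  have "(1 - q) * profile p \<le> p' - p"
  proof (rule LIMSEQ_le_const)
    show "(\<lambda>n. (1 - q) * growth (Suc n) + (1 - q) * (grid_tail q (Suc n) + \<bar>p - inside (Suc n)\<bar>))
        \<longlonglongrightarrow> p' - p"
      using tendsto_add[OF gro tendsto_mult[OF tendsto_const[of "1 - q"]
          tendsto_add[OF tail tendsto_rabs[OF tendsto_diff[OF tendsto_const[of p] ins]]]]]
      by simp
    have "(1 - q) * profile p
        \<le> (1 - q) * growth (Suc n) + (1 - q) * (grid_tail q (Suc n) + \<bar>p - inside (Suc n)\<bar>)" for n
    proof -
      have "profile p \<le> profile (inside (Suc n)) + \<bar>p - inside (Suc n)\<bar>"
        using p inside_nonneg mass_bounds by (intro profile_lipschitz) auto
      then have "profile p \<le> growth (Suc n) + (grid_tail q (Suc n) + \<bar>p - inside (Suc n)\<bar>)"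
        using profile_inside_le_growth[of n] by simp
      then show ?thesis using q01 by (simp flip: distrib_left)
    qed
    then show "\<exists>N. \<forall>n\<ge>N. (1 - q) * profile p
        \<le> (1 - q) * growth (Suc n) + (1 - q) * (grid_tail q (Suc n) + \<bar>p - inside (Suc n)\<bar>)"
      by blast
  qed
  then show ?thesis by simp
qed

end

section \<open>The product exponential measure\<close>

definition exp_measure :: "real measure" where
  "exp_measure = density lborel (\<lambda>x. ennreal (exp (- x) * indicator {0..} x))"

lemma sets_exp_measure [simp, measurable_cong]: "sets exp_measure = sets borel"
  by (simp add: exp_measure_def)

lemma space_exp_measure [simp]: "space exp_measure = UNIV"
  by (simp add: exp_measure_def)

lemma emeasure_exp_measure_atLeast:
  assumes "0 \<le> a"
  shows "emeasure exp_measure {a..} = exp (- a)"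
proof -
  have "emeasure exp_measure {a..} = (\<integral>\<^sup>+x. ennreal (exp (- x)) * indicator {a..} x \<partial>lborel)"
    unfolding exp_measure_def using assms
    by (subst emeasure_density) (auto intro!: nn_integral_cong simp: indicator_def)
  also have "\<dots> = ennreal (0 - (- exp (- a)))"
  proof (rule nn_integral_FTC_atLeast)
    show "((\<lambda>x::real. - exp (- x)) \<longlongrightarrow> 0) at_top"
      using tendsto_minus[OF filterlim_compose[OF exp_at_bot filterlim_uminus_at_bot_at_top]] by simp
  qed (auto intro!: derivative_eq_intros)
  finally show ?thesis by simp
qed

lemma emeasure_exp_measure_UNIV: "emeasure exp_measure UNIV = 1"
proof -
  have "emeasure exp_measure UNIV = emeasure exp_measure {0..}"
    unfolding exp_measure_def
    by (simp add: emeasure_density indicator_def, intro nn_integral_cong) (auto simp: indicator_def)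
  then show ?thesis using emeasure_exp_measure_atLeast[of 0] by simp
qed

interpretation exp_measure: finite_measure exp_measure
  by standard (simp add: emeasure_exp_measure_UNIV)

lemma emeasure_exp_measure_interval:
  assumes "0 \<le> a" "a \<le> b"
  shows "emeasure exp_measure {a..<b} = ennreal (exp (- a) - exp (- b))"
proof -
  have "emeasure exp_measure ({a..} - {b..}) = emeasure exp_measure {a..} - emeasure exp_measure {b..}"
    using assms by (intro emeasure_Diff) auto
  moreover have "{a..} - {b..} = {a..<b}" by auto
  ultimately show ?thesis
    using assms by (simp add: emeasure_exp_measure_atLeast ennreal_minus)
qed

lemma nu_eq_pair: "nu = exp_measure \<Otimes>\<^sub>M exp_measure"
proof -
  have "exp_measure \<Otimes>\<^sub>M exp_measure
      = density (lborel \<Otimes>\<^sub>M lborel) (\<lambda>(x, y). ennreal (exp (- x) * indicator {0..} x) *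
          ennreal (exp (- y) * indicator {0..} y))"
    unfolding exp_measure_def
    using exp_measure.sigma_finite_measure_axioms[unfolded exp_measure_def]
    by (intro pair_measure_density) (auto intro: lborel.sigma_finite_measure_axioms)
  also have "\<dots> = nu"
    unfolding nu_def lborel_prod
    by (intro arg_cong2[where f = density] ext)
       (auto simp: quadrant_def indicator_def exp_diff exp_minus field_simps simp flip: ennreal_mult)
  finally show ?thesis by simp
qed

lemma sets_nu [simp, measurable_cong]: "sets nu = sets borel"
  by (simp add: nu_def)

lemma space_nu [simp]: "space nu = UNIV"
  by (simp add: nu_def)

lemma emeasure_nu_UNIV: "emeasure nu UNIV = 1"
  using exp_measure.emeasure_pair_measure_Times[of UNIV exp_measure UNIV]
  by (simp add: nu_eq_pair emeasure_exp_measure_UNIV)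

interpretation nu: finite_measure nu
  by standard (simp add: emeasure_nu_UNIV)

lemma measure_nu_UNIV: "measure nu UNIV = 1"
  by (simp add: measure_def emeasure_nu_UNIV)

lemma measure_nu_le_1: "measure nu X \<le> 1"
  using nu.bounded_measure[of X] by (simp add: measure_nu_UNIV)

definition cell :: "real \<Rightarrow> nat \<times> nat \<Rightarrow> (real \<times> real) set" where
  "cell \<delta> c = {real (fst c) * \<delta>..<(real (fst c) + 1) * \<delta>} \<times> {real (snd c) * \<delta>..<(real (snd c) + 1) * \<delta>}"

lemma cell_borel [simp]: "cell \<delta> c \<in> sets borel"
  unfolding cell_def by (subst borel_prod[symmetric]) (intro pair_measureI; simp)

lemma cell_disjoint:
  assumes "0 < \<delta>" "x \<in> cell \<delta> c" "x \<in> cell \<delta> d"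
  shows "c = d"
proof -
  have "i = k" if "real i * \<delta> \<le> z" "z < (real i + 1) * \<delta>" "real k * \<delta> \<le> z" "z < (real k + 1) * \<delta>" for i k :: nat and z
  proof -
    have "real i * \<delta> < (real k + 1) * \<delta>" "real k * \<delta> < (real i + 1) * \<delta>" using that by linarith+
    then have "real i < real k + 1" "real k < real i + 1" using assms(1) by simp_all
    then show ?thesis by linarith
  qed
  then show ?thesis using assms by (auto simp: cell_def prod_eq_iff mem_Times_iff)
qed

lemma measure_cell:
  assumes "0 < \<delta>"
  shows "measure nu (cell \<delta> (i, j)) = (1 - exp (- \<delta>))\<^sup>2 * exp (- \<delta>) ^ (i + j)"
proof -
  have one: "emeasure exp_measure {real k * \<delta>..<(real k + 1) * \<delta>} = ennreal ((1 - exp (- \<delta>)) * exp (- \<delta>) ^ k)"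
    for k :: nat
  proof -
    have "exp (- (k * \<delta>)) - exp (- ((real k + 1) * \<delta>)) = (1 - exp (- \<delta>)) * exp (- \<delta>) ^ k"
      by (simp add: algebra_simps exp_add[symmetric] flip: exp_of_nat_mult)
    then show ?thesis using assms by (subst emeasure_exp_measure_interval) auto
  qed
  have "emeasure nu (cell \<delta> (i, j)) = ennreal ((1 - exp (- \<delta>)) * exp (- \<delta>) ^ i) *
      ennreal ((1 - exp (- \<delta>)) * exp (- \<delta>) ^ j)"
    unfolding nu_eq_pair cell_def by (subst exp_measure.emeasure_pair_measure_Times) (auto simp: one)
  also have "\<dots> = ennreal ((1 - exp (- \<delta>))\<^sup>2 * exp (- \<delta>) ^ (i + j))"
    using assms by (simp add: power_add power2_eq_square ac_simps flip: ennreal_mult)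
  finally show ?thesis using assms by (simp add: measure_def)
qed

lemma emeasure_simplex:
  assumes "0 \<le> t"
  shows "emeasure nu {x. l1_norm x \<le> t} = ennreal (1 - (1 + t) * exp (- t))"
proof -
  define X where "X = {x :: real \<times> real. l1_norm x \<le> t}"
  have X: "X \<in> sets (exp_measure \<Otimes>\<^sub>M exp_measure)"
  proof -
    have "closed X" unfolding X_def l1_norm_def
      by (intro closed_Collect_le continuous_intros)
    then show ?thesis by (subst nu_eq_pair[symmetric]) (simp add: borel_closed)
  qed
  have vertical: "emeasure exp_measure (Pair x -` X) = ennreal (1 - exp (x - t))"
    if "0 \<le> x" "x \<le> t" for x
  proof -
    have "Pair x -` X = {-(t - x)..t - x}" using that by (auto simp: X_def l1_norm_def)
    moreover have "emeasure exp_measure {-(t - x)..t - x}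
        = (\<integral>\<^sup>+y. ennreal (exp (- y)) * indicator {0..t - x} y \<partial>lborel)"
      unfolding exp_measure_def using that
      by (subst emeasure_density) (auto intro!: nn_integral_cong simp: indicator_def)
    moreover have "\<dots> = ennreal (- exp (- (t - x)) - (- exp (- 0)))"
      using that by (intro nn_integral_FTC_Icc) (auto intro!: derivative_eq_intros)
    ultimately show ?thesis by simp
  qed
  have "emeasure nu X = (\<integral>\<^sup>+x. emeasure exp_measure (Pair x -` X) \<partial>exp_measure)"
    unfolding nu_eq_pair by (rule exp_measure.emeasure_pair_measure_alt[OF X])
  also have "\<dots> = (\<integral>\<^sup>+x. ennreal (exp (- x) * indicator {0..} x) * emeasure exp_measure (Pair x -` X) \<partial>lborel)"
    using exp_measure.measurable_emeasure_Pair[OF X] unfolding exp_measure_def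
    by (intro nn_integral_density) simp_all
  also have "\<dots> = (\<integral>\<^sup>+x. ennreal (exp (- x) - exp (- t)) * indicator {0..t} x \<partial>lborel)"
  proof (rule nn_integral_cong)
    fix x :: real
    consider "x < 0" | "0 \<le> x" "x \<le> t" | "t < x" by linarith
    then show "ennreal (exp (- x) * indicator {0..} x) * emeasure exp_measure (Pair x -` X)
        = ennreal (exp (- x) - exp (- t)) * indicator {0..t} x"
    proof cases
      case 2
      have "exp (- x) * (1 - exp (x - t)) = exp (- x) - exp (- t)"
        by (simp add: algebra_simps flip: exp_add)
      then show ?thesis using 2 by (simp add: vertical flip: ennreal_mult)
    next
      case 3
      then have "Pair x -` X = {}" using assms by (auto simp: X_def l1_norm_def)
      then show ?thesis using 3 by simp
    qed simp
  qed
  also have "\<dots> = ennreal ((- exp (- t) - t * exp (- t)) - (- exp (- 0) - 0 * exp (- t)))"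
    using assms by (intro nn_integral_FTC_Icc) (auto intro!: derivative_eq_intros)
  also have "\<dots> = ennreal (1 - (1 + t) * exp (- t))" by (simp add: algebra_simps)
  finally show ?thesis by (simp add: X_def)
qed

lemma one_add_mult_exp_minus_le_1: "0 \<le> t \<Longrightarrow> (1 + t) * exp (- t) \<le> (1 :: real)"
  using exp_ge_add_one_self[of t] by (simp add: exp_minus field_simps)

lemma measure_simplex:
  assumes "0 \<le> t"
  shows "measure nu {x. l1_norm x \<le> t} = 1 - (1 + t) * exp (- t)"
  using emeasure_simplex[OF assms] one_add_mult_exp_minus_le_1[OF assms] by (simp add: measure_def)

lemma measure_quadrant_Int:
  assumes "X \<in> sets borel"
  shows "measure nu (quadrant \<inter> X) = measure nu X"
proof -
  have quadrant: "quadrant \<in> sets borel"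
    unfolding quadrant_def by (intro borel_closed closed_Collect_conj closed_Collect_le continuous_intros)
  have "(\<lambda>x :: real \<times> real. exp (- fst x - snd x)) \<in> borel_measurable borel"
    by (intro borel_measurable_continuous_onI continuous_intros)
  then have density: "(\<lambda>x. ennreal (exp (- fst x - snd x) * indicator quadrant x)) \<in> borel_measurable lborel"
    using quadrant by simp
  have "emeasure nu (quadrant \<inter> X) = emeasure nu X"
    unfolding nu_def using assms quadrant
    by (subst (1 2) emeasure_density[OF density]) (auto intro!: nn_integral_cong simp: indicator_def)
  then show ?thesis by (simp add: measure_def)
qed

section \<open>From the grid to Borel sets\<close>

definition region :: "real \<Rightarrow> (nat \<times> nat) set \<Rightarrow> (real \<times> real) set" where
  "region \<delta> S = (\<Union>c\<in>S. cell \<delta> c)"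

lemma region_borel [simp]: "region \<delta> S \<in> sets borel"
  unfolding region_def by (intro sets.countable_UN') auto

lemma measure_region_sums:
  fixes q :: real
  assumes "0 < \<delta>" "q = exp (- \<delta>)"
  shows "(\<lambda>n. (1 - q)\<^sup>2 * q ^ n * card (slice S n)) sums measure nu (region \<delta> S)"
proof -
  define R where "R n = (\<Union>i\<in>slice S n. cell \<delta> (i, n - i))" for n
  have union: "region \<delta> S = (\<Union>n. R n)"
  proof (intro equalityI subsetI)
    fix x assume "x \<in> region \<delta> S"
    then obtain i j where "(i, j) \<in> S" "x \<in> cell \<delta> (i, j)" by (auto simp: region_def)
    then have "i \<in> slice S (i + j)" "x \<in> cell \<delta> (i, i + j - i)" by (auto simp: slice_def)
    then have "x \<in> R (i + j)" unfolding R_def by blast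
    then show "x \<in> (\<Union>n. R n)" by auto
  next
    fix x assume "x \<in> (\<Union>n. R n)"
    then show "x \<in> region \<delta> S" by (auto simp: R_def slice_def region_def)
  qed
  have "R n \<in> sets borel" for n
    unfolding R_def by (intro sets.finite_UN) auto
  moreover have "disjoint_family R"
    unfolding disjoint_family_on_def
  proof (intro ballI impI, rule ccontr)
    fix m n :: nat assume ne: "m \<noteq> n" "R m \<inter> R n \<noteq> {}"
    then obtain x i j where x: "x \<in> cell \<delta> (i, m - i)" "i \<le> m" "x \<in> cell \<delta> (j, n - j)" "j \<le> n"
      by (auto simp: R_def slice_def)
    have "(i, m - i) = (j, n - j)" by (rule cell_disjoint[OF assms(1) x(1,3)])
    then show False using x ne by auto
  qed
  ultimately have "(\<lambda>n. measure nu (R n)) sums measure nu (\<Union>n. R n)"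
    by (intro nu.finite_measure_UNION) auto
  moreover have "measure nu (R n) = (1 - q)\<^sup>2 * q ^ n * card (slice S n)" for n
  proof -
    have "measure nu (R n) = (\<Sum>i\<in>slice S n. measure nu (cell \<delta> (i, n - i)))"
      unfolding R_def
    proof (rule nu.finite_measure_finite_Union)
      show "disjoint_family_on (\<lambda>i. cell \<delta> (i, n - i)) (slice S n)"
        using cell_disjoint[OF assms(1)] by (fastforce simp: disjoint_family_on_def)
    qed auto
    also have "\<dots> = (\<Sum>i\<in>slice S n. (1 - q)\<^sup>2 * q ^ n)"
      using assms by (intro sum.cong) (auto simp: measure_cell slice_def)
    finally show ?thesis by simp
  qed
  ultimately show ?thesis by (simp add: union)
qed

lemma grid_step_measure:
  assumes "0 < \<delta>" "\<delta> \<le> 1 / 8"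
  shows "measure nu (region \<delta> S) + (1 - exp (- \<delta>)) * profile (measure nu (region \<delta> S))
    \<le> measure nu (region \<delta> (grid_step S))"
proof -
  interpret level_sequences \<delta> "exp (- \<delta>)" "\<lambda>n. card (slice S n)" "\<lambda>n. card (slice (grid_step S) n)"
    using assms card_slice_le card_slice_le_grid_step card_slice_above card_slice_below
    by unfold_locales auto
  show ?thesis
    by (rule discrete_isoperimetry; rule measure_region_sums[OF assms(1) refl])
qed

lemma grid_steps_distance:
  assumes "(i, j) \<in> (grid_step ^^ m) S"
  shows "\<exists>(k, l)\<in>S. \<bar>int i - int k\<bar> + \<bar>int j - int l\<bar> \<le> m"
  using assms
proof (induction m arbitrary: i j)
  case 0
  then show ?case by (auto intro!: bexI[of _ "(i, j)"])
next
  case (Suc m)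
  then obtain i' j' where *: "(i', j') \<in> (grid_step ^^ m) S" "\<bar>int i - int i'\<bar> + \<bar>int j - int j'\<bar> \<le> 1"
    unfolding funpow.simps comp_def by (subst (asm) (2) grid_step_def) auto
  from Suc.IH[OF *(1)] obtain k l where "(k, l) \<in> S" "\<bar>int i' - int k\<bar> + \<bar>int j' - int l\<bar> \<le> m"
    by auto
  with *(2) show ?case by (intro bexI[of _ "(k, l)"]) auto
qed

text \<open>
  The index distance \<open>m\<close> gives distance at most \<open>m * \<delta>\<close> between corners of cells, and the position
  inside a cell costs less than \<open>\<delta>\<close> in each coordinate.
\<close>

lemma region_grid_steps_subset_nbhd:
  assumes "0 < \<delta>"
  shows "region \<delta> ((grid_step ^^ m) {c. cell \<delta> c \<inter> A \<noteq> {}}) \<subseteq> l1_nbhd A ((real m + 2) * \<delta>)"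
proof
  fix x assume "x \<in> region \<delta> ((grid_step ^^ m) {c. cell \<delta> c \<inter> A \<noteq> {}})"
  then obtain i j where ij: "(i, j) \<in> (grid_step ^^ m) {c. cell \<delta> c \<inter> A \<noteq> {}}" "x \<in> cell \<delta> (i, j)"
    by (auto simp: region_def)
  from grid_steps_distance[OF ij(1)] obtain k l y where
    y: "y \<in> cell \<delta> (k, l)" "y \<in> A" "\<bar>int i - int k\<bar> + \<bar>int j - int l\<bar> \<le> m"
    by blast
  have coordinate: "\<bar>u - v\<bar> < (\<bar>real i - real k\<bar> + 1) * \<delta>"
    if "real i * \<delta> \<le> u" "u < (real i + 1) * \<delta>" "real k * \<delta> \<le> v" "v < (real k + 1) * \<delta>"
    for i k :: nat and u v
  proof -
    have "(real i - real k) * \<delta> \<le> \<bar>real i - real k\<bar> * \<delta>" "(real k - real i) * \<delta> \<le> \<bar>real i - real k\<bar> * \<delta>"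
      using assms by (intro mult_right_mono; simp)+
    with that show ?thesis by (simp add: algebra_simps abs_less_iff)
  qed
  have "l1_norm (x - y) < (\<bar>real i - real k\<bar> + 1) * \<delta> + (\<bar>real j - real l\<bar> + 1) * \<delta>"
    using ij(2) y(1) coordinate unfolding l1_norm_def cell_def
    by (intro add_strict_mono) (auto simp: mem_Times_iff)
  also have "\<dots> = (\<bar>real i - real k\<bar> + \<bar>real j - real l\<bar> + 2) * \<delta>"
    by (simp add: algebra_simps)
  also have "\<dots> \<le> (real m + 2) * \<delta>"
    using y(3) assms by (intro mult_right_mono) linarith+
  finally show "x \<in> l1_nbhd A ((real m + 2) * \<delta>)" using y(2) by (auto simp: l1_nbhd_def)
qed

lemma subset_region_touching_cells:
  assumes "0 < \<delta>" "A \<subseteq> quadrant"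
  shows "A \<subseteq> region \<delta> {c. cell \<delta> c \<inter> A \<noteq> {}}"
proof
  fix x assume x: "x \<in> A"
  have coordinate: "real (nat \<lfloor>u / \<delta>\<rfloor>) * \<delta> \<le> u \<and> u < (real (nat \<lfloor>u / \<delta>\<rfloor>) + 1) * \<delta>"
    if "0 \<le> u" for u
  proof -
    have "0 \<le> u / \<delta>" using that assms by simp
    then have "real (nat \<lfloor>u / \<delta>\<rfloor>) \<le> u / \<delta>" "u / \<delta> < real (nat \<lfloor>u / \<delta>\<rfloor>) + 1" by linarith+
    then show ?thesis using assms by (simp add: field_simps)
  qed
  have "x \<in> cell \<delta> (nat \<lfloor>fst x / \<delta>\<rfloor>, nat \<lfloor>snd x / \<delta>\<rfloor>)"
    using x assms coordinate by (auto simp: cell_def quadrant_def mem_Times_iff)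
  then show "x \<in> region \<delta> {c. cell \<delta> c \<inter> A \<noteq> {}}" using x by (auto simp: region_def)
qed

lemma open_l1_nbhd: "open (l1_nbhd A h)"
proof -
  have "l1_nbhd A h = (\<Union>y\<in>A. {x. l1_norm (x - y) < h})" by (auto simp: l1_nbhd_def)
  moreover have "open {x. l1_norm (x - y) < h}" for y
    unfolding l1_norm_def by (intro open_Collect_less continuous_intros)
  ultimately show ?thesis by auto
qed

lemma l1_nbhd_borel [simp]: "l1_nbhd A h \<in> sets borel"
  by (simp add: open_l1_nbhd)

lemma subset_l1_nbhd: "0 < h \<Longrightarrow> A \<subseteq> l1_nbhd A h"
  by (force simp: l1_nbhd_def l1_norm_def)

text \<open>
  The \<open>h\<close>-neighbourhood contains \<open>k\<close> grid steps of mesh \<open>h / (k + 2)\<close>, and each step adds at least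
  \<open>(1 - exp (- \<delta>)) * profile m\<close> to the current measure \<open>m\<close>. Until the measure has grown by \<open>h\<close>,
  which would be more than enough, the Lipschitz bound keeps \<open>profile m\<close> above \<open>profile p - h\<close>.
  As the mesh tends to \<open>0\<close>, the total factor \<open>k * (1 - exp (- \<delta>))\<close> tends to \<open>h\<close>. Starting from all
  the cells that \<open>A\<close> touches, rather than from those inside \<open>A\<close>, keeps the initial measure above \<open>p\<close>.
\<close>

lemma enlargement_lower_bound:
  assumes A: "A \<in> sets borel" "A \<subseteq> quadrant" and h: "0 < h"
  defines "p \<equiv> measure nu A"
  shows "p + h * (profile p - h) \<le> measure nu (l1_nbhd A h)"
proof (cases "profile p \<le> h")
  case True
  have "p \<le> measure nu (l1_nbhd A h)"
    unfolding p_def using h by (intro nu.finite_measure_mono subset_l1_nbhd) auto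
  moreover have "h * (profile p - h) \<le> 0" using h True by (simp add: mult_nonneg_nonpos)
  ultimately show ?thesis by linarith
next
  case False
  have p: "0 \<le> p" "p \<le> 1" by (auto simp: p_def measure_nu_le_1)
  have profile_le_1: "profile p \<le> 1" using profile_le_self[OF p] p by simp
  define \<delta> where "\<delta> k = h / (real k + 2)" for k :: nat
  define \<theta> where "\<theta> k = 1 - exp (- \<delta> k)" for k
  have bound: "p + min h (k * \<theta> k * (profile p - h)) \<le> measure nu (l1_nbhd A h)"
    if small: "\<delta> k \<le> 1 / 8" for k :: nat
  proof -
    define S where "S = {c. cell (\<delta> k) c \<inter> A \<noteq> {}}"
    define m where "m j = measure nu (region (\<delta> k) ((grid_step ^^ j) S))" for j
    have \<delta>: "0 < \<delta> k" using h by (simp add: \<delta>_def)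
    have \<theta>: "0 < \<theta> k" using \<delta> by (simp add: \<theta>_def)
    have m01: "0 \<le> m j" "m j \<le> 1" for j by (auto simp: m_def measure_nu_le_1)
    have step: "m j + \<theta> k * profile (m j) \<le> m (Suc j)" for j
      using grid_step_measure[OF \<delta> small] by (simp add: m_def \<theta>_def)
    have "p + min h (j * \<theta> k * (profile p - h)) \<le> m j" for j :: nat
    proof (induction j)
      case 0
      have "p \<le> m 0"
        unfolding p_def m_def S_def using subset_region_touching_cells[OF \<delta> A(2)]
        by (intro nu.finite_measure_mono) auto
      then show ?case using h by simp
    next
      case (Suc j)
      have mono: "m j \<le> m (Suc j)"
        using step[of j] mult_nonneg_nonneg[OF less_imp_le[OF \<theta>] profile_nonneg[OF m01[of j]]]
        by linarith
      show ?case
      proof (cases "p + h \<le> m j")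
        case True
        then show ?thesis using mono by simp
      next
        case far: False
        have "0 \<le> j * \<theta> k * (profile p - h)" using \<theta> False by simp
        then have "p + j * \<theta> k * (profile p - h) \<le> m j" "p \<le> m j"
          using Suc.IH far h by (auto simp: min_def split: if_splits)
        moreover have "profile p \<le> profile (m j) + \<bar>p - m j\<bar>"
          using p m01 by (intro profile_lipschitz)
        ultimately have "profile p - h \<le> profile (m j)" using far by linarith
        then have "\<theta> k * (profile p - h) \<le> \<theta> k * profile (m j)"
          using \<theta> by (intro mult_left_mono) auto
        with step[of j] \<open>p + j * \<theta> k * (profile p - h) \<le> m j\<close>
        have "p + Suc j * \<theta> k * (profile p - h) \<le> m (Suc j)"
          by (simp add: algebra_simps)
        then show ?thesis by linarith
      qed
    qed
    moreover have "m k \<le> measure nu (l1_nbhd A h)"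
    proof -
      have "(real k + 2) * \<delta> k = h" by (simp add: \<delta>_def add_nonneg_eq_0_iff)
      then show ?thesis
        unfolding m_def S_def using region_grid_steps_subset_nbhd[OF \<delta>, of k A]
        by (intro nu.finite_measure_mono) auto
    qed
    ultimately show ?thesis using order_trans by blast
  qed
  have "(\<lambda>k. real k * \<theta> k) \<longlonglongrightarrow> h"
    unfolding \<theta>_def \<delta>_def using h by real_asymp
  then have "(\<lambda>k. p + min h (k * \<theta> k * (profile p - h))) \<longlonglongrightarrow> p + min h (h * (profile p - h))"
    by (intro tendsto_intros)
  moreover have "eventually (\<lambda>k. \<delta> k \<le> 1 / 8) sequentially"
    unfolding \<delta>_def by real_asymp
  then have "eventually (\<lambda>k. p + min h (k * \<theta> k * (profile p - h)) \<le> measure nu (l1_nbhd A h)) sequentially"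
    by eventually_elim (rule bound)
  ultimately have "p + min h (h * (profile p - h)) \<le> measure nu (l1_nbhd A h)"
    by (rule tendsto_upperbound) simp
  moreover have "h * (profile p - h) \<le> h * 1"
    using h profile_le_1 by (intro mult_left_mono) auto
  ultimately show ?thesis by simp
qed

theorem profile_le_nu_plus:
  assumes "A \<in> sets borel" "A \<subseteq> quadrant"
  shows "ereal (profile (measure nu A)) \<le> nu_plus A"
proof -
  define p where "p = measure nu A"
  have "((\<lambda>h. ereal (profile p - h)) \<longlongrightarrow> ereal (profile p - 0)) (at_right 0)"
    by (intro tendsto_intros)
  then have "ereal (profile p) = Liminf (at_right 0) (\<lambda>h. ereal (profile p - h))"
    by (subst lim_imp_Liminf) auto
  also have "\<dots> \<le> nu_plus A"
    unfolding nu_plus_def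
  proof (rule Liminf_mono)
    show "eventually (\<lambda>h. ereal (profile p - h) \<le> ereal ((measure nu (l1_nbhd A h) - measure nu A) / h)) (at_right 0)"
      using eventually_at_right_less[of 0]
    proof eventually_elim
      case (elim h)
      show ?case
        using enlargement_lower_bound[OF assms elim] elim by (simp add: p_def field_simps)
    qed
  qed
  finally show ?thesis by (simp add: p_def)
qed

section \<open>Balls and their complements\<close>

definition ball_tail :: "ereal \<Rightarrow> real" where
  "ball_tail t = (if t = \<infinity> then 0 else (1 + real_of_ereal t) * exp (- real_of_ereal t))"

lemma measure_l1_ball:
  assumes "0 < t"
  shows "measure nu (l1_ball t) = 1 - ball_tail t"
  using assms measure_simplex measure_nu_UNIV by (cases t) (auto simp: l1_ball_def ball_tail_def)

lemma l1_ball_borel [simp]: "l1_ball t \<in> sets borel"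
proof -
  have "closed (l1_ball t)"
    unfolding l1_ball_def l1_norm_def by (intro closed_Collect_le continuous_intros)
  then show ?thesis by (rule borel_closed)
qed

lemma measure_l1_ball_complement:
  assumes "0 < t"
  shows "measure nu (quadrant - l1_ball t) = ball_tail t"
proof -
  have "measure nu (quadrant - l1_ball t) = measure nu (quadrant \<inter> (UNIV - l1_ball t))"
    by (simp add: Diff_eq)
  also have "\<dots> = measure nu (UNIV - l1_ball t)" by (intro measure_quadrant_Int) auto
  also have "\<dots> = 1 - measure nu (l1_ball t)"
    using nu.finite_measure_Diff[of UNIV "l1_ball t"] by (simp add: measure_nu_UNIV)
  finally show ?thesis using assms by (simp add: measure_l1_ball)
qed

lemma ball_tail_strict_antimono:
  fixes s t :: real
  assumes "0 \<le> s" "s < t"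
  shows "(1 + t) * exp (- t) < (1 + s) * exp (- s)"
proof -
  have "1 + t \<le> (1 + s) * (1 + (t - s))"
    using assms by (simp add: algebra_simps mult_left_mono)
  also have "\<dots> < (1 + s) * exp (t - s)"
    using assms exp_minus_greater[of "s - t"] by (intro mult_strict_left_mono) auto
  finally have "(1 + t) * exp (- t) < (1 + s) * exp (t - s) * exp (- t)"
    by (intro mult_strict_right_mono) auto
  then show ?thesis by (simp add: mult.assoc flip: exp_add)
qed

lemma ball_tail_ex1:
  assumes "0 \<le> r" "r < 1"
  shows "\<exists>!t. 0 < t \<and> ball_tail t = r"
proof -
  have "\<exists>t>0. ball_tail t = r"
  proof (cases "r = 0")
    case True
    then show ?thesis by (intro exI[of _ \<infinity>]) (simp add: ball_tail_def)
  next
    case False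
    have "((\<lambda>t::real. (1 + t) * exp (- t)) \<longlongrightarrow> 0) at_top" by real_asymp
    then have "eventually (\<lambda>t::real. (1 + t) * exp (- t) < r) at_top"
      using assms False by (intro order_tendstoD) auto
    from eventually_conj[OF this eventually_ge_at_top[of 0]]
    obtain T :: real where T: "0 \<le> T" "(1 + T) * exp (- T) < r"
      unfolding eventually_at_top_linorder by blast
    have "\<exists>t\<ge>0. t \<le> T \<and> (1 + t) * exp (- t) = r"
      using assms T by (intro IVT2') (auto intro!: continuous_intros)
    then obtain t where t: "0 \<le> t" "(1 + t) * exp (- t) = r" by blast
    then have "t \<noteq> 0" using assms by auto
    with t show ?thesis by (intro exI[of _ "ereal t"]) (simp add: ball_tail_def)
  qed
  moreover have "s = t" if "0 < s" "0 < t" "ball_tail s = ball_tail t" for s t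
  proof (cases s; cases t)
    fix a b assume "s = ereal a" "t = ereal b"
    then show ?thesis
      using that ball_tail_strict_antimono[of a b] ball_tail_strict_antimono[of b a]
      by (cases a b rule: linorder_cases) (auto simp: ball_tail_def)
  qed (use that in \<open>auto simp: ball_tail_def\<close>)
  ultimately show ?thesis by metis
qed

lemma extremal_radius_tail:
  defines "p \<equiv> \<lambda>A. measure nu A"
  shows "0 < extremal_radius A"
    and "ball_tail (extremal_radius A) = (if p A \<ge> 1 / 2 then 1 - p A else p A)"
proof -
  define r where "r = (if p A \<ge> 1 / 2 then 1 - p A else p A)"
  have r: "0 \<le> r" "r < 1" using measure_nu_le_1[of A] by (auto simp: r_def p_def)
  have "0 < t \<and> measure nu (extremal_shape A t) = measure nu A \<longleftrightarrow> 0 < t \<and> ball_tail t = r" for t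
    by (auto simp: extremal_shape_def r_def p_def measure_l1_ball measure_l1_ball_complement)
  then have "extremal_radius A = (THE t. 0 < t \<and> ball_tail t = r)"
    by (simp add: extremal_radius_def)
  then have "0 < extremal_radius A \<and> ball_tail (extremal_radius A) = r"
    using theI'[OF ball_tail_ex1[OF r]] by simp
  then show "0 < extremal_radius A"
    "ball_tail (extremal_radius A) = (if p A \<ge> 1 / 2 then 1 - p A else p A)"
    by (auto simp: r_def)
qed

lemma nu_plus_le:
  assumes "eventually (\<lambda>h. (measure nu (l1_nbhd A h) - measure nu A) / h \<le> g h) (at_right 0)"
    and "(g \<longlongrightarrow> L) (at_right 0)"
  shows "nu_plus A \<le> ereal L"
proof -
  have "nu_plus A \<le> Liminf (at_right 0) (\<lambda>h. ereal (g h))"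
    unfolding nu_plus_def using assms(1) by (intro Liminf_mono) simp
  also have "\<dots> = ereal L"
    using assms(2) by (intro lim_imp_Liminf) auto
  finally show ?thesis .
qed

lemma l1_norm_triangle: "l1_norm x \<le> l1_norm y + l1_norm (x - y)" "l1_norm y \<le> l1_norm x + l1_norm (x - y)"
  by (auto simp: l1_norm_def)

lemma nu_plus_l1_ball_le:
  assumes "0 < t"
  shows "nu_plus (l1_ball (ereal t)) \<le> ereal (t * exp (- t))"
proof (rule nu_plus_le)
  show "eventually (\<lambda>h. (measure nu (l1_nbhd (l1_ball (ereal t)) h) - measure nu (l1_ball (ereal t))) / h
      \<le> ((1 + t) * exp (- t) - (1 + (t + h)) * exp (- (t + h))) / h) (at_right 0)"
    using eventually_at_right_less[of 0]
  proof eventually_elim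
    case (elim h)
    have "l1_nbhd (l1_ball (ereal t)) h \<subseteq> l1_ball (ereal (t + h))"
    proof
      fix x assume "x \<in> l1_nbhd (l1_ball (ereal t)) h"
      then obtain y where "l1_norm y \<le> t" "l1_norm (x - y) < h"
        by (auto simp: l1_nbhd_def l1_ball_def)
      then show "x \<in> l1_ball (ereal (t + h))"
        using l1_norm_triangle(1)[of x y] by (simp add: l1_ball_def)
    qed
    then have "measure nu (l1_nbhd (l1_ball (ereal t)) h) \<le> measure nu (l1_ball (ereal (t + h)))"
      by (intro nu.finite_measure_mono) auto
    then show ?case
      using assms elim by (intro divide_right_mono) (auto simp: measure_l1_ball ball_tail_def)
  qed
  have "((\<lambda>h. ((1 + t) * exp (- t) - (1 + (t + h)) * exp (- (t + h))) / h)
      \<longlongrightarrow> (1 + t) * exp (- t) - exp (- t)) (at_right 0)"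
    by real_asymp
  also have "(1 + t) * exp (- t) - exp (- t) = t * exp (- t)" by (simp add: algebra_simps)
  finally show "((\<lambda>h. ((1 + t) * exp (- t) - (1 + (t + h)) * exp (- (t + h))) / h) \<longlongrightarrow> t * exp (- t)) (at_right 0)" .
qed

lemma nu_plus_l1_ball_complement_le:
  assumes "0 < t"
  shows "nu_plus (quadrant - l1_ball (ereal t)) \<le> ereal (t * exp (- t))"
proof (rule nu_plus_le)
  let ?C = "quadrant - l1_ball (ereal t)"
  show "eventually (\<lambda>h. (measure nu (l1_nbhd ?C h) - measure nu ?C) / h
      \<le> ((1 + (t - h)) * exp (- (t - h)) - (1 + t) * exp (- t)) / h) (at_right 0)"
    using eventually_at_right_less[of 0] eventually_at_right_real[OF assms]
  proof eventually_elim
    case (elim h)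
    have "l1_nbhd ?C h \<subseteq> UNIV - l1_ball (ereal (t - h))"
    proof
      fix x assume "x \<in> l1_nbhd ?C h"
      then obtain y where "t < l1_norm y" "l1_norm (x - y) < h"
        unfolding l1_nbhd_def l1_ball_def by (smt (verit) DiffD2 ereal_less_eq(3) mem_Collect_eq)
      then show "x \<in> UNIV - l1_ball (ereal (t - h))"
        using l1_norm_triangle(2)[of y x] by (simp add: l1_ball_def)
    qed
    then have "measure nu (l1_nbhd ?C h) \<le> measure nu (UNIV - l1_ball (ereal (t - h)))"
      by (intro nu.finite_measure_mono) auto
    also have "\<dots> = ball_tail (ereal (t - h))"
      using nu.finite_measure_Diff[of UNIV "l1_ball (ereal (t - h))"] elim
      by (simp add: measure_nu_UNIV measure_l1_ball)
    finally show ?case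
      using assms elim
      by (intro divide_right_mono) (auto simp: measure_l1_ball_complement ball_tail_def)
  qed
  have "((\<lambda>h. ((1 + (t - h)) * exp (- (t - h)) - (1 + t) * exp (- t)) / h)
      \<longlongrightarrow> (1 + t) * exp (- t) - exp (- t)) (at_right 0)"
    by real_asymp
  also have "(1 + t) * exp (- t) - exp (- t) = t * exp (- t)" by (simp add: algebra_simps)
  finally show "((\<lambda>h. ((1 + (t - h)) * exp (- (t - h)) - (1 + t) * exp (- t)) / h) \<longlongrightarrow> t * exp (- t)) (at_right 0)" .
qed

lemma nu_plus_nonneg:
  assumes "A \<in> sets borel" "A \<subseteq> quadrant"
  shows "0 \<le> nu_plus A"
  using order_trans[OF _ profile_le_nu_plus[OF assms]] profile_nonneg measure_nu_le_1 by simp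

text \<open>
  Infinite radius occurs exactly for sets of measure \<open>0\<close> or \<open>1\<close>.
\<close>

lemma nu_plus_extremal_set_infinite:
  assumes "extremal_radius A = \<infinity>"
  shows "nu_plus (extremal_set A) \<le> 0"
proof -
  have "extremal_set A = UNIV \<or> extremal_set A = {}"
    using assms by (auto simp: extremal_set_def extremal_shape_def l1_ball_def)
  moreover have "l1_nbhd UNIV h = UNIV" if "0 < h" for h using subset_l1_nbhd[OF that] by auto
  ultimately have "eventually (\<lambda>h. (measure nu (l1_nbhd (extremal_set A) h) - measure nu (extremal_set A)) / h \<le> 0)
      (at_right 0)"
    using eventually_at_right_less[of 0] by (auto elim!: eventually_mono simp: l1_nbhd_def)
  from nu_plus_le[OF this tendsto_const] show ?thesis by (simp add: zero_ereal_def)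
qed

theorem theorem2:
  fixes A :: "(real \<times> real) set"
  assumes "A \<in> sets borel" and "A \<subseteq> quadrant"
  shows "nu_plus A \<ge> nu_plus (extremal_set A)"
proof (cases "extremal_radius A")
  case (real t)
  define p where "p = measure nu A"
  have t: "0 < t" using extremal_radius_tail(1)[of A] real by simp
  have tail: "(1 + t) * exp (- t) = (if p \<ge> 1 / 2 then 1 - p else p)"
    using extremal_radius_tail(2)[of A] real by (simp add: ball_tail_def p_def)
  have "nu_plus (extremal_set A) \<le> ereal (t * exp (- t))"
    using nu_plus_l1_ball_le[OF t] nu_plus_l1_ball_complement_le[OF t] real
    by (simp add: extremal_set_def extremal_shape_def)
  also have "t * exp (- t) \<le> profile ((1 + t) * exp (- t))"
    using t tail by (intro ball_perimeter_le_profile) auto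
  also have "profile ((1 + t) * exp (- t)) = profile p"
    unfolding tail by (simp add: profile_symmetric)
  also have "ereal (profile p) \<le> nu_plus A"
    unfolding p_def by (rule profile_le_nu_plus[OF assms])
  finally show ?thesis by simp
next
  case PInf
  then show ?thesis
    using nu_plus_extremal_set_infinite nu_plus_nonneg[OF assms] order_trans by blast
next
  case MInf
  then show ?thesis using extremal_radius_tail(1)[of A] by simp
qed

end
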